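(* There exists an absolute constant $C>0$ such that for all $n,p\in\mathbb{N}$, all $f\in C_B[0,\infty)$ and all $x\in[0,\infty)$, $$|\mathcal{L}_{n,p}(f,x)-f(x)|\le C\,\omega_2\left(f,\sqrt{\delta_n(x)+(\alpha_n(x))^2}\right)+\omega(f,\alpha_n(x)).$$
   Context: $\mathbb{N}$ denotes the positive integers. For $n,p\in\mathbb{N}$ and suitable $f:[0,\infty)\to\mathbb{R}$, the Baskakov-Schurer-Szász operator is $$\mathcal{L}_{n,p}(f,x)=(n+p)\sum_{k=0}^{\infty}b^k_{n,p}(x)\int_0^\infty f(t)\,s^k_{n,p}(t)\,dt,\qquad x\in[0,\infty),$$ where $b^k_{n,p}(x)=\binom{n+p+k-1}{k}\frac{x^k}{(1+x)^{n+p+k}}$ and $s^k_{n,p}(t)=e^{-(n+p)t}\frac{((n+p)t)^k}{k!}$. $\alpha_n(x):=\mathcal{L}_{n,p}(t-x;x)=\frac{1}{n+p}$ and $\delta_n(x):=\mathcal{L}_{n,p}((t-x)^2;x)=\frac{1}{n+p}x^2+\frac{2}{n+p}x+\frac{2}{(n+p)^2}$ (the operator acts in the variable $t$). $C_B[0,\infty)$ is the space of continuous bounded real functions on $[0,\infty)$. For $f\in C_B[0,\infty)$ and $\delta>0$, $$\omega_2(f,\delta)=\sup_{0<h\le\delta}\ \sup_{x\in[0,\infty)}|f(x+2h)-2f(x+h)+f(x)|,\qquad \omega(f,\delta)=\sup_{0<h\le\delta}\ \sup_{x\in[0,\infty)}|f(x+h)-f(x)|.$$ *)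

theory Defs
  imports "HOL-Analysis.Analysis"
begin

text \<open>
  Functions on \<open>[0, \<infinity>)\<close> are represented by total functions \<open>real \<Rightarrow> real\<close>; every notion
  below depends only on their values on \<open>{0..}\<close> when \<open>x \<ge> 0\<close>.
\<close>

definition baskakov_basis :: "nat \<Rightarrow> nat \<Rightarrow> nat \<Rightarrow> real \<Rightarrow> real" where
  "baskakov_basis n p k x =
     real ((n + p + k - 1) choose k) * (x ^ k / (1 + x) ^ (n + p + k))"

definition szasz_basis :: "nat \<Rightarrow> nat \<Rightarrow> nat \<Rightarrow> real \<Rightarrow> real" where
  "szasz_basis n p k t = exp (- (real (n + p) * t)) * ((real (n + p) * t) ^ k / fact k)"

definition BSS_operator :: "nat \<Rightarrow> nat \<Rightarrow> (real \<Rightarrow> real) \<Rightarrow> real \<Rightarrow> real" where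
  "BSS_operator n p f x =
     real (n + p) *
       (\<Sum>k. baskakov_basis n p k x * (LINT t:{0..}|lborel. f t * szasz_basis n p k t))"

definition BSS_alpha :: "nat \<Rightarrow> nat \<Rightarrow> real \<Rightarrow> real" where
  "BSS_alpha n p x = BSS_operator n p (\<lambda>t. t - x) x"

definition BSS_delta :: "nat \<Rightarrow> nat \<Rightarrow> real \<Rightarrow> real" where
  "BSS_delta n p x = BSS_operator n p (\<lambda>t. (t - x)\<^sup>2) x"

definition CB_halfline :: "(real \<Rightarrow> real) set" where
  "CB_halfline = {f. continuous_on {0..} f \<and> bounded (f ` {0..})}"

text \<open>
  The suprema are taken in \<open>real\<close>, hence are meaningful for \<open>f\<close> bounded on \<open>{0..}\<close> and \<open>d > 0\<close>.
\<close>

definition modulus_continuity :: "(real \<Rightarrow> real) \<Rightarrow> real \<Rightarrow> real" where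
  "modulus_continuity f d = (SUP h\<in>{0<..d}. SUP x\<in>{0..}. \<bar>f (x + h) - f x\<bar>)"

definition modulus_smoothness2 :: "(real \<Rightarrow> real) \<Rightarrow> real \<Rightarrow> real" where
  "modulus_smoothness2 f d =
     (SUP h\<in>{0<..d}. SUP x\<in>{0..}. \<bar>f (x + 2 * h) - 2 * f (x + h) + f x\<bar>)"

end

theory Submission
  imports Defs "HOL-Probability.Distributions"
begin

text \<open>
  The operator is the expectation of \<open>f\<close> under a probability law on the half-line: a negative
  binomial index \<open>k\<close>, followed by an Erlang variable with parameters \<open>k\<close> and \<open>n + p\<close>. Its bias
  \<open>\<alpha>\<close> is positive, so linear functions are reproduced only up to a shift: \<open>f\<close> is compared with
  \<open>f (x + \<alpha>)\<close> first, and the passage from \<open>f (x + \<alpha>)\<close> to \<open>f x\<close> costs the term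
  \<open>\<omega>(f, \<alpha>)\<close>.

  For the comparison with \<open>f (x + \<alpha>)\<close>, put \<open>h\<^sup>2 = \<delta> + \<alpha>\<^sup>2\<close> and \<open>W = \<omega>\<^sub>2(f, h)\<close>. The Steklov mean
  \<open>g\<close> of second order with step \<open>h\<close> satisfies \<open>\<bar>f - g\<bar> \<le> W\<close> and \<open>\<bar>g''\<bar> \<le> 9 W / h\<^sup>2\<close>
  (lemma \<open>Steklov_smoothing\<close>). Replacing \<open>g\<close> by its tangent at \<open>x\<close> gives an affine function
  whose distance from \<open>f\<close> at every \<open>t \<ge> 0\<close> is at most \<open>W + 9/2 (W / h\<^sup>2) (t - x)\<^sup>2\<close>
  (lemma \<open>affine_approximation\<close>). This one pointwise inequality is used twice. The operator is
  positive and sends an affine function \<open>q\<close> to \<open>q (x + \<alpha>)\<close> and \<open>(t - x)\<^sup>2\<close> to \<open>\<delta>\<close>, so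
  \<open>L f\<close> lies within \<open>W + 9/2 (W / h\<^sup>2) \<delta>\<close> of \<open>q (x + \<alpha>)\<close>; taking \<open>t = x + \<alpha>\<close> shows that
  \<open>f (x + \<alpha>)\<close> lies within \<open>W + 9/2 (W / h\<^sup>2) \<alpha>\<^sup>2\<close> of the same number. The choice of \<open>h\<close> makes
  these errors add up to \<open>2 W + 9/2 W\<close>, hence the constant \<open>13/2\<close>.

  Only \<open>f\<close> and quadratic polynomials are ever inserted into the operator, so the analytic work
  on the operator reduces to the convergence of its first two moments, its value on constants, and
  the positivity of \<open>\<alpha>\<close>, without which \<open>\<omega>(f, \<alpha>)\<close> would be a supremum over the empty set.
\<close>

section \<open>Moments of the two bases\<close>

text \<open>
  On the half-line the Szasz basis function is the Erlang density divided by the rate \<open>n + p\<close>,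
  which accounts for the additional power of \<open>n + p\<close> compared with the Erlang moments.
\<close>

lemma szasz_basis_moment:
  assumes "n + p > 0"
  shows "has_bochner_integral lborel
           (\<lambda>t. indicator {0..} t *\<^sub>R (t ^ i * szasz_basis n p k t))
           (fact (k + i) / (fact k * real (n + p) ^ Suc i))"
proof -
  define l where "l = real (n + p)"
  have l: "l > 0" unfolding l_def of_nat_0_less_iff by (rule assms)
  have basis: "szasz_basis n p k t = exp (- (l * t)) * ((l * t) ^ k / fact k)" for t
    by (simp only: szasz_basis_def l_def)
  have eq: "indicator {0..} t *\<^sub>R (t ^ i * szasz_basis n p k t)
      = (erlang_density k l t * t ^ i) / l" for t
    unfolding basis using l
    by (cases "t < 0") (simp_all add: erlang_density_def power_mult_distrib)
  have "has_bochner_integral lborel (\<lambda>t. erlang_density k l t * t ^ i) (fact (k + i) / (fact k * l ^ i))"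
  proof (rule has_bochner_integral_nn_integral)
    show "(\<lambda>t. erlang_density k l t * t ^ i) \<in> borel_measurable lborel" by measurable
    show "AE t in lborel. 0 \<le> erlang_density k l t * t ^ i"
      using l by (auto simp: erlang_density_def)
    show "(\<integral>\<^sup>+ t. ennreal (erlang_density k l t * t ^ i) \<partial>lborel) = ennreal (fact (k + i) / (fact k * l ^ i))"
      using nn_integral_erlang_ith_moment[OF l, of k i] by simp
  qed (use l in simp)
  from has_bochner_integral_divide_zero[OF this, of l]
  show ?thesis unfolding eq using l by (simp add: l_def field_simps)
qed

lemma baskakov_basis_nonneg: "x \<ge> 0 \<Longrightarrow> baskakov_basis n p k x \<ge> 0"
  by (simp add: baskakov_basis_def)

text \<open>
  This is the binomial series for \<open>(1 - z)\<close> to the power \<open>- (n + p)\<close> at \<open>z = x / (1 + x)\<close>.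
\<close>

lemma baskakov_basis_sums_1:
  assumes "n + p > 0" "x \<ge> 0"
  shows "(\<lambda>k. baskakov_basis n p k x) sums 1"
proof -
  define N where "N = n + p"
  define z where "z = x / (1 + x)"
  have N: "N > 0" using assms by (simp add: N_def)
  have z: "0 \<le> z" "z < 1" using assms by (auto simp: z_def)
  have z1: "1 - z = inverse (1 + x)" using assms by (auto simp: z_def field_simps)
  have "(\<lambda>k. (- real N gchoose k) * (- z) ^ k) sums (1 + (- z)) powr (- real N)"
    by (rule gen_binomial_real) (use z in auto)
  moreover have "(- real N gchoose k) * (- z) ^ k = real ((N + k - 1) choose k) * z ^ k" for k
  proof -
    have "real N + real k - 1 = real (N + k - 1)" using N by simp
    hence "(- real N gchoose k) = (-1) ^ k * real ((N + k - 1) choose k)"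
      using gbinomial_minus[of "real N" k] by (simp only: binomial_gbinomial)
    thus ?thesis by (subst power_minus[of z]) (simp add: mult_ac)
  qed
  moreover have "(1 + (- z)) powr (- real N) = (1 + x) ^ N"
    using assms z1 by (simp add: powr_minus powr_realpow power_inverse)
  ultimately have "(\<lambda>k. real ((N + k - 1) choose k) * z ^ k) sums (1 + x) ^ N" by simp
  from sums_divide[OF this, of "(1 + x) ^ N"] assms
  have "(\<lambda>k. real ((N + k - 1) choose k) * z ^ k / (1 + x) ^ N) sums 1" by simp
  moreover have "real ((N + k - 1) choose k) * z ^ k / (1 + x) ^ N = baskakov_basis n p k x" for k
    by (simp add: baskakov_basis_def z_def N_def power_divide power_add)
  ultimately show ?thesis by simp
qed

text \<open>
  Absorbing the factor \<open>k\<close> into the binomial coefficient shifts the index and raises the parameter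
  \<open>p\<close>. Iterating this reduces every factorial moment to the total mass, which is known for all
  parameters.
\<close>

lemma Suc_times_baskakov_basis:
  assumes "n + p > 0"
  shows "real (Suc k) * baskakov_basis n p (Suc k) x
           = real (n + p) * x * baskakov_basis n (Suc p) k x"
proof -
  have "Suc k * ((n + p + k) choose Suc k) = (n + p) * ((n + p + k) choose k)"
    using binomial_absorption[of k "n + p + k"] binomial_absorb_comp[of "n + p + k" k] assms
    by (simp add: mult.commute)
  hence "real (Suc k) * real ((n + p + k) choose Suc k) = real (n + p) * real ((n + p + k) choose k)"
    by (metis of_nat_mult)
  thus ?thesis
    by (simp add: baskakov_basis_def del: of_nat_Suc)
qed

lemma baskakov_basis_sums_mean:
  assumes "n + p > 0" "x \<ge> 0"
  shows "(\<lambda>k. real k * baskakov_basis n p k x) sums (real (n + p) * x)"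
proof -
  have "(\<lambda>k. real (n + p) * x * baskakov_basis n (Suc p) k x) sums (real (n + p) * x * 1)"
    by (intro sums_mult baskakov_basis_sums_1) (use assms in auto)
  hence "(\<lambda>k. real (Suc k) * baskakov_basis n p (Suc k) x) sums (real (n + p) * x)"
    by (subst Suc_times_baskakov_basis) (use assms in simp_all)
  from sums_Suc[OF this] show ?thesis by simp
qed

lemma baskakov_basis_summable_square:
  assumes "n + p > 0" "x \<ge> 0"
  shows "summable (\<lambda>k. (real k)\<^sup>2 * baskakov_basis n p k x)"
proof -
  have "summable (\<lambda>k. real (n + p) * x *
      (real k * baskakov_basis n (Suc p) k x + baskakov_basis n (Suc p) k x))"
  proof (rule summable_mult, rule summable_add)
    show "summable (\<lambda>k. real k * baskakov_basis n (Suc p) k x)"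
      by (rule sums_summable[OF baskakov_basis_sums_mean]) (use assms in auto)
    show "summable (\<lambda>k. baskakov_basis n (Suc p) k x)"
      by (rule sums_summable[OF baskakov_basis_sums_1]) (use assms in auto)
  qed
  also have "(\<lambda>k. real (n + p) * x *
      (real k * baskakov_basis n (Suc p) k x + baskakov_basis n (Suc p) k x))
      = (\<lambda>k. (real (Suc k))\<^sup>2 * baskakov_basis n p (Suc k) x)"
  proof
    fix k
    show "real (n + p) * x *
      (real k * baskakov_basis n (Suc p) k x + baskakov_basis n (Suc p) k x)
      = (real (Suc k))\<^sup>2 * baskakov_basis n p (Suc k) x"
    proof -
      have "real (n + p) * x *
          (real k * baskakov_basis n (Suc p) k x + baskakov_basis n (Suc p) k x)
        = real (Suc k) * (real (n + p) * x * baskakov_basis n (Suc p) k x)"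
        by (simp add: algebra_simps)
      also have "\<dots> = real (Suc k) * (real (Suc k) * baskakov_basis n p (Suc k) x)"
        by (simp only: Suc_times_baskakov_basis[OF assms(1)])
      finally show ?thesis by (simp only: power2_eq_square mult.assoc)
    qed
  qed
  finally show ?thesis by (subst summable_Suc_iff[symmetric])
qed

section \<open>The operator as a positive linear functional\<close>

text \<open>
  Lebesgue integrals and infinite sums have default values when they do not converge. The operator
  is therefore linear and monotone only on functions for which all integrals and the outer series
  converge.
\<close>

definition BSS_admissible :: "nat \<Rightarrow> nat \<Rightarrow> real \<Rightarrow> (real \<Rightarrow> real) \<Rightarrow> bool" where
  "BSS_admissible n p x f \<longleftrightarrow>
     (\<forall>k. set_integrable lborel {0..} (\<lambda>t. f t * szasz_basis n p k t)) \<and>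
     summable (\<lambda>k. baskakov_basis n p k x * (LINT t:{0..}|lborel. f t * szasz_basis n p k t))"

lemma BSS_admissible_add:
  assumes "BSS_admissible n p x f" "BSS_admissible n p x g"
  shows "BSS_admissible n p x (\<lambda>t. f t + g t)"
    and "BSS_operator n p (\<lambda>t. f t + g t) x = BSS_operator n p f x + BSS_operator n p g x"
proof -
  have eq: "(LINT t:{0..}|lborel. (f t + g t) * szasz_basis n p k t)
     = (LINT t:{0..}|lborel. f t * szasz_basis n p k t) + (LINT t:{0..}|lborel. g t * szasz_basis n p k t)" for k
    using assms unfolding BSS_admissible_def distrib_right by (intro set_integral_add(2)) auto
  show "BSS_admissible n p x (\<lambda>t. f t + g t)"
    using assms unfolding BSS_admissible_def eq unfolding distrib_right distrib_left
    by (auto intro: summable_add)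
  show "BSS_operator n p (\<lambda>t. f t + g t) x = BSS_operator n p f x + BSS_operator n p g x"
    using assms unfolding BSS_admissible_def BSS_operator_def eq
    by (simp add: distrib_left suminf_add[symmetric])
qed

lemma BSS_admissible_cmult:
  assumes "BSS_admissible n p x f"
  shows "BSS_admissible n p x (\<lambda>t. c * f t)"
    and "BSS_operator n p (\<lambda>t. c * f t) x = c * BSS_operator n p f x"
proof -
  have eq: "(LINT t:{0..}|lborel. c * f t * szasz_basis n p k t)
     = c * (LINT t:{0..}|lborel. f t * szasz_basis n p k t)" for k
    by (simp add: mult.assoc)
  have eq2: "(\<lambda>k. baskakov_basis n p k x * (c * (LINT t:{0..}|lborel. f t * szasz_basis n p k t)))
     = (\<lambda>k. c * (baskakov_basis n p k x * (LINT t:{0..}|lborel. f t * szasz_basis n p k t)))"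
    by (simp add: mult_ac)
  show "BSS_admissible n p x (\<lambda>t. c * f t)"
    using assms unfolding BSS_admissible_def eq eq2 by (auto simp: mult.assoc intro: summable_mult)
  show "BSS_operator n p (\<lambda>t. c * f t) x = c * BSS_operator n p f x"
    using assms unfolding BSS_admissible_def BSS_operator_def eq eq2
    by (simp add: suminf_mult)
qed

lemma szasz_basis_nonneg: "t \<ge> 0 \<Longrightarrow> szasz_basis n p k t \<ge> 0"
  by (simp add: szasz_basis_def)

lemma BSS_operator_mono:
  assumes "BSS_admissible n p x f" "BSS_admissible n p x g"
    and "\<And>t. t \<ge> 0 \<Longrightarrow> f t \<le> g t" and "x \<ge> 0"
  shows "BSS_operator n p f x \<le> BSS_operator n p g x"
  unfolding BSS_operator_def
proof (intro mult_left_mono suminf_le)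
  fix k
  show "(LINT t:{0..}|lborel. f t * szasz_basis n p k t) \<le> (LINT t:{0..}|lborel. g t * szasz_basis n p k t)"
    using assms unfolding BSS_admissible_def
    by (intro set_integral_mono mult_right_mono szasz_basis_nonneg) auto
qed (use assms in \<open>auto simp: BSS_admissible_def baskakov_basis_nonneg\<close>)

text \<open>
  The integral of \<open>t ^ i\<close> against the \<open>k\<close>-th Szasz function is, up to a constant factor, a
  polynomial of degree \<open>i\<close> in \<open>k\<close>, so convergence follows from that of the first two moments of
  the Baskakov weights.
\<close>

lemma BSS_admissible_monomial:
  assumes "n + p > 0" "x \<ge> 0" "i \<le> 2"
  shows "BSS_admissible n p x (\<lambda>t. t ^ i)"
proof -
  have "summable (\<lambda>k. baskakov_basis n p k x * (fact (k + i) / (fact k * real (n + p) ^ Suc i)))"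
  proof -
    have s: "summable (\<lambda>k. baskakov_basis n p k x * ((real k)\<^sup>2 + 3 * real k + 2))"
      using summable_add[OF summable_add[OF baskakov_basis_summable_square
          summable_mult[OF sums_summable[OF baskakov_basis_sums_mean], of _ _ _ 3]]
          summable_mult[OF sums_summable[OF baskakov_basis_sums_1], of _ _ _ 2]] assms
      by (simp add: algebra_simps)
    have "summable (\<lambda>k. (fact (k + i) / fact k) * baskakov_basis n p k x)"
    proof (rule summable_comparison_test'[OF s])
      fix k
      have "(fact (k + i) / fact k :: real) \<le> (real k)\<^sup>2 + 3 * real k + 2"
      proof -
        consider "i = 0" | "i = 1" | "i = 2" using assms(3) by linarith
        thus ?thesis
          by cases (auto simp: numeral_2_eq_2 field_simps power2_eq_square)
      qed
      from mult_left_mono[OF this baskakov_basis_nonneg[OF assms(2), of n p k]]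
      show "norm ((fact (k + i) / fact k) * baskakov_basis n p k x)
         \<le> baskakov_basis n p k x * ((real k)\<^sup>2 + 3 * real k + 2)"
        by (simp add: abs_mult baskakov_basis_nonneg[OF assms(2)] mult.commute)
    qed
    from summable_mult[OF this, of "inverse (real (n + p) ^ Suc i)"]
    show ?thesis by (simp add: field_simps)
  qed
  moreover have "(LINT t:{0..}|lborel. t ^ i * szasz_basis n p k t) = fact (k + i) / (fact k * real (n + p) ^ Suc i)" for k
    using szasz_basis_moment[OF assms(1)] unfolding set_lebesgue_integral_def
    by (rule has_bochner_integral_integral_eq)
  moreover have "set_integrable lborel {0..} (\<lambda>t. t ^ i * szasz_basis n p k t)" for k
    using szasz_basis_moment[OF assms(1)] unfolding set_integrable_def
    by (rule integrable.intros)
  ultimately show ?thesis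
    unfolding BSS_admissible_def by simp
qed

lemma BSS_operator_const:
  assumes "n + p > 0" "x \<ge> 0"
  shows "BSS_operator n p (\<lambda>t. c) x = c"
proof -
  have I: "(LINT t:{0..}|lborel. c * szasz_basis n p k t) = c / real (n + p)" for k
    using has_bochner_integral_integral_eq[OF szasz_basis_moment[OF assms(1), of 0 k]]
    by (simp add: set_lebesgue_integral_def)
  have "(\<Sum>k. baskakov_basis n p k x * (c / real (n + p))) = 1 * (c / real (n + p))"
    by (intro sums_unique[symmetric] sums_mult2 baskakov_basis_sums_1 assms)
  thus ?thesis using assms(1) unfolding BSS_operator_def I by (simp del: of_nat_add)
qed

text \<open>
  The mean of the Erlang variable is \<open>(k + 1) / (n + p)\<close>; the summand \<open>1\<close> is the source of the
  bias of the operator.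
\<close>

lemma BSS_operator_ident:
  assumes "n + p > 0" "x \<ge> 0"
  shows "BSS_operator n p (\<lambda>t. t) x = x + 1 / real (n + p)"
proof -
  define N where "N = real (n + p)"
  have N: "N > 0" unfolding N_def of_nat_0_less_iff by (rule assms)
  have I: "(LINT t:{0..}|lborel. t * szasz_basis n p k t) = (real k + 1) / N\<^sup>2" for k
    using has_bochner_integral_integral_eq[OF szasz_basis_moment[OF assms(1), of 1 k]]
    by (simp add: set_lebesgue_integral_def N_def power2_eq_square)
  have "(\<lambda>k. (real k * baskakov_basis n p k x + baskakov_basis n p k x) / N\<^sup>2) sums ((N * x + 1) / N\<^sup>2)"
    unfolding N_def
    by (intro sums_divide sums_add baskakov_basis_sums_1 baskakov_basis_sums_mean assms)
  also have "(\<lambda>k. (real k * baskakov_basis n p k x + baskakov_basis n p k x) / N\<^sup>2)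
     = (\<lambda>k. baskakov_basis n p k x * ((real k + 1) / N\<^sup>2))"
    by (simp add: field_simps)
  finally have "(\<Sum>k. baskakov_basis n p k x * ((real k + 1) / N\<^sup>2)) = (N * x + 1) / N\<^sup>2"
    by (rule sums_unique[symmetric])
  thus ?thesis using N unfolding BSS_operator_def I N_def[symmetric]
    by (simp add: field_simps power2_eq_square)
qed

lemma BSS_admissible_centered:
  assumes "n + p > 0" "x \<ge> 0"
  shows "BSS_admissible n p x (\<lambda>t. c)"
    and "BSS_admissible n p x (\<lambda>t. t - x)"
    and "BSS_admissible n p x (\<lambda>t. (t - x)\<^sup>2)"
proof -
  note mon = BSS_admissible_monomial[OF assms]
  show c: "BSS_admissible n p x (\<lambda>t. c)" for c
    using BSS_admissible_cmult(1)[OF mon[of 0], of c] by simp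
  show "BSS_admissible n p x (\<lambda>t. t - x)"
    using BSS_admissible_add(1)[OF mon[of 1] c[of "- x"]] by simp
  have "BSS_admissible n p x (\<lambda>t. t\<^sup>2 + (- 2 * x) * t ^ 1 + x\<^sup>2)"
    by (intro BSS_admissible_add BSS_admissible_cmult mon c) auto
  thus "BSS_admissible n p x (\<lambda>t. (t - x)\<^sup>2)"
    by (simp add: power2_eq_square algebra_simps)
qed

lemma BSS_alpha_eq:
  assumes "n + p > 0" "x \<ge> 0"
  shows "BSS_alpha n p x = 1 / real (n + p)"
proof -
  have "BSS_operator n p (\<lambda>t. t + (- x)) x = x + 1 / real (n + p) + (- x)"
    using BSS_admissible_add(2)[of n p x "\<lambda>t. t" "\<lambda>t. - x"]
      BSS_admissible_monomial[OF assms, of 1] BSS_admissible_centered(1)[OF assms]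
      BSS_operator_const[OF assms] BSS_operator_ident[OF assms] by simp
  thus ?thesis by (simp add: BSS_alpha_def)
qed

lemma BSS_delta_nonneg:
  assumes "n + p > 0" "x \<ge> 0"
  shows "BSS_delta n p x \<ge> 0"
  using BSS_operator_mono[of n p x "\<lambda>t. 0" "\<lambda>t. (t - x)\<^sup>2"] BSS_operator_const[OF assms, of 0]
    BSS_admissible_centered[OF assms] assms(2)
  by (simp add: BSS_delta_def)

lemma BSS_operator_quadratic:
  assumes "n + p > 0" "x \<ge> 0"
  shows "BSS_admissible n p x (\<lambda>t. a + b * (t - x) + c * (t - x)\<^sup>2)"
    and "BSS_operator n p (\<lambda>t. a + b * (t - x) + c * (t - x)\<^sup>2) x
           = a + b * BSS_alpha n p x + c * BSS_delta n p x"
proof -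
  note adm = BSS_admissible_centered[OF assms]
  note lin = BSS_admissible_add(1)[OF adm(1) BSS_admissible_cmult(1)[OF adm(2)], of a b]
  note quad = BSS_admissible_cmult(1)[OF adm(3), of c]
  show "BSS_admissible n p x (\<lambda>t. a + b * (t - x) + c * (t - x)\<^sup>2)"
    by (rule BSS_admissible_add(1)[OF lin quad])
  show "BSS_operator n p (\<lambda>t. a + b * (t - x) + c * (t - x)\<^sup>2) x
           = a + b * BSS_alpha n p x + c * BSS_delta n p x"
    by (simp add: BSS_admissible_add(2)[OF lin quad] BSS_admissible_cmult(2)[OF adm(2)]
        BSS_admissible_cmult(2)[OF adm(3)] BSS_operator_const[OF assms] BSS_alpha_def BSS_delta_def
        BSS_admissible_add(2)[OF adm(1) BSS_admissible_cmult(1)[OF adm(2)]])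
qed

text \<open>
  Constants are admissible, and a bound \<open>K\<close> of \<open>\<bar>f\<bar>\<close> dominates both the integrals and the series.
\<close>

lemma BSS_admissible_CB_halfline:
  assumes "n + p > 0" "x \<ge> 0" "f \<in> CB_halfline"
  shows "BSS_admissible n p x f"
proof -
  from assms(3) obtain K where K: "\<And>t. t \<ge> 0 \<Longrightarrow> \<bar>f t\<bar> \<le> K"
    by (auto simp: CB_halfline_def bounded_iff)
  have cont: "continuous_on {0..} f" using assms(3) by (simp add: CB_halfline_def)
  note admK = BSS_admissible_centered(1)[OF assms(1,2), of K]
  have bd: "\<bar>f t * szasz_basis n p k t\<bar> \<le> K * szasz_basis n p k t" if "t \<ge> 0" for k t
    using K[OF that] szasz_basis_nonneg[OF that, of n p k] by (simp add: abs_mult mult_right_mono)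
  have int: "set_integrable lborel {0..} (\<lambda>t. f t * szasz_basis n p k t)" for k
  proof (rule set_integrable_bound)
    show "set_integrable lborel {0..} (\<lambda>t. K * szasz_basis n p k t)"
      using admK by (simp add: BSS_admissible_def)
    show "AE t in lborel. t \<in> {0..} \<longrightarrow> norm (f t * szasz_basis n p k t) \<le> norm (K * szasz_basis n p k t)"
      by (auto intro!: AE_I2 order_trans[OF bd abs_ge_self])
    have prod: "continuous_on {0..} (\<lambda>t. f t * szasz_basis n p k t)"
      unfolding szasz_basis_def by (intro continuous_intros cont) auto
    show "set_borel_measurable lborel {0..} (\<lambda>t. f t * szasz_basis n p k t)"
      using borel_measurable_continuous_on_indicator[OF _ prod]
      by (simp add: set_borel_measurable_def)
  qed
  have "summable (\<lambda>k. baskakov_basis n p k x * (LINT t:{0..}|lborel. f t * szasz_basis n p k t))"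
  proof (rule summable_comparison_test')
    show "summable (\<lambda>k. baskakov_basis n p k x * (LINT t:{0..}|lborel. K * szasz_basis n p k t))"
      using admK by (simp add: BSS_admissible_def)
    fix k
    have intK: "set_integrable lborel {0..} (\<lambda>t. K * szasz_basis n p k t)"
      using admK by (simp add: BSS_admissible_def)
    have "\<bar>LINT t:{0..}|lborel. f t * szasz_basis n p k t\<bar> \<le> (LINT t:{0..}|lborel. \<bar>f t * szasz_basis n p k t\<bar>)"
      using set_integral_norm_bound[OF int] by simp
    also have "\<dots> \<le> (LINT t:{0..}|lborel. K * szasz_basis n p k t)"
      using bd by (intro set_integral_mono set_integrable_abs int intK) auto
    finally show "norm (baskakov_basis n p k x * (LINT t:{0..}|lborel. f t * szasz_basis n p k t))
       \<le> baskakov_basis n p k x * (LINT t:{0..}|lborel. K * szasz_basis n p k t)"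
      using baskakov_basis_nonneg[OF assms(2), of n p k] by (simp add: abs_mult mult_left_mono)
  qed
  with int show ?thesis by (simp add: BSS_admissible_def)
qed

section \<open>Steklov smoothing\<close>

text \<open>
  The bound on the second derivative is required only between the two points: the functions below
  are controlled on the half-line and not beyond it.
\<close>

lemma Taylor_second_order_bound:
  fixes g :: "real \<Rightarrow> real"
  assumes "\<And>s. (g has_field_derivative g' s) (at s)"
    and "\<And>s. (g' has_field_derivative g'' s) (at s)"
    and M: "\<And>s. s \<in> closed_segment x t \<Longrightarrow> \<bar>g'' s\<bar> \<le> M"
  shows "\<bar>g t - g x - g' x * (t - x)\<bar> \<le> M / 2 * (t - x)\<^sup>2"
proof (cases "t = x")
  case False
  define diff where "diff m = (if m = 0 then g else if m = 1 then g' else g'')" for m :: nat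
  have "\<exists>s. (if t < x then t < s \<and> s < x else x < s \<and> s < t) \<and>
      g t = (\<Sum>m<2. diff m x / fact m * (t - x) ^ m) + diff 2 s / fact 2 * (t - x) ^ 2"
    by (rule Taylor[where a = "min t x" and b = "max t x"])
      (use False assms(1,2) in \<open>auto simp: diff_def less_2_cases_iff\<close>)
  then obtain s where s: "if t < x then t < s \<and> s < x else x < s \<and> s < t"
    and eq: "g t = g x + g' x * (t - x) + g'' s / 2 * (t - x)\<^sup>2"
    by (auto simp: diff_def numeral_2_eq_2)
  from s have "s \<in> closed_segment x t" by (auto simp: closed_segment_eq_real_ivl split: if_splits)
  from M[OF this] have "\<bar>g'' s\<bar> / 2 * (t - x)\<^sup>2 \<le> M / 2 * (t - x)\<^sup>2"
    by (intro mult_right_mono) auto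
  moreover have "\<bar>g t - g x - g' x * (t - x)\<bar> = \<bar>g'' s\<bar> / 2 * (t - x)\<^sup>2"
    using eq by (simp add: abs_mult)
  ultimately show ?thesis by simp
qed simp

text \<open>
  Expanding about the midpoint \<open>a\<close> cancels the first-order terms.
\<close>

lemma second_difference_bound:
  fixes G :: "real \<Rightarrow> real"
  assumes "\<And>s. (G has_field_derivative G' s) (at s)"
    and "\<And>s. (G' has_field_derivative G'' s) (at s)"
    and "a \<ge> 0" and "\<And>s. s \<in> {0..2 * a} \<Longrightarrow> \<bar>G'' s\<bar> \<le> M"
  shows "\<bar>G (2 * a) - 2 * G a + G 0\<bar> \<le> M * a\<^sup>2"
proof -
  have right: "\<bar>G (2 * a) - G a - G' a * (2 * a - a)\<bar> \<le> M / 2 * (2 * a - a)\<^sup>2"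
    by (rule Taylor_second_order_bound[OF assms(1,2)])
      (use assms(3) in \<open>auto intro!: assms(4) simp: closed_segment_eq_real_ivl split: if_splits\<close>)
  have left: "\<bar>G 0 - G a - G' a * (0 - a)\<bar> \<le> M / 2 * (0 - a)\<^sup>2"
    by (rule Taylor_second_order_bound[OF assms(1,2)])
      (use assms(3) in \<open>auto intro!: assms(4) simp: closed_segment_eq_real_ivl split: if_splits\<close>)
  from right have "\<bar>G (2 * a) - G a - G' a * a\<bar> \<le> M * a\<^sup>2 / 2" by simp
  moreover from left have "\<bar>G 0 - G a + G' a * a\<bar> \<le> M * a\<^sup>2 / 2" by simp
  ultimately show ?thesis by linarith
qed

text \<open>
  The classical second-order Steklov mean is
  \<open>g t = 4 / h\<^sup>2 \<integral>\<integral> (2 f (t + u + v) - f (t + 2 (u + v))) du dv\<close> over the square of side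
  \<open>h / 2\<close>. Its double integrals are second differences of a second antiderivative \<open>F2\<close> of \<open>f\<close>,
  which gives \<open>g = (8 \<Delta>\<^sub>h\<^sub>/\<^sub>2 F2 - \<Delta>\<^sub>h F2) / h\<^sup>2\<close>, where \<open>\<Delta>\<^sub>s\<close> is the second forward difference
  with step \<open>s\<close>. In this form \<open>g''\<close> is the same combination of second differences of \<open>f\<close>, hence
  the factor \<open>9 = 8 + 1\<close>.
\<close>

lemma Steklov_smoothing:
  fixes f :: "real \<Rightarrow> real"
  assumes cont: "continuous_on UNIV f" and h: "h > 0"
    and W: "\<And>s t. 0 < s \<Longrightarrow> s \<le> h \<Longrightarrow> t \<ge> 0 \<Longrightarrow> \<bar>f (t + 2 * s) - 2 * f (t + s) + f t\<bar> \<le> W"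
  obtains g g' g'' :: "real \<Rightarrow> real"
  where "\<And>t. (g has_field_derivative g' t) (at t)"
    and "\<And>t. (g' has_field_derivative g'' t) (at t)"
    and "\<And>t. t \<ge> 0 \<Longrightarrow> \<bar>f t - g t\<bar> \<le> W"
    and "\<And>t. t \<ge> 0 \<Longrightarrow> \<bar>g'' t\<bar> \<le> 9 * W / h\<^sup>2"
proof -
  have antideriv: "\<exists>F. \<forall>t. (F has_field_derivative u t) (at t)" if "continuous_on UNIV u" for u :: "real \<Rightarrow> real"
    using einterval_antiderivative[of "-\<infinity>" \<infinity> u] that
    by (auto simp: continuous_on_eq_continuous_at has_real_derivative_iff_has_vector_derivative)
  obtain F1 where F1: "\<And>t. (F1 has_field_derivative f t) (at t)" using antideriv[OF cont] by blast
  have "continuous_on UNIV F1"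
    using F1 by (auto simp: continuous_on_eq_continuous_at intro: DERIV_isCont)
  then obtain F2 where F2: "\<And>t. (F2 has_field_derivative F1 t) (at t)" using antideriv by blast
  define D where "D u s t = u (t + 2 * s) - 2 * u (t + s) + u t" for u :: "real \<Rightarrow> real" and s t
  have D_deriv: "(D u s has_field_derivative D u' s t) (at t)"
    if "\<And>t. (u has_field_derivative u' t) (at t)" for u u' s t
    unfolding D_def
    by (auto intro!: derivative_eq_intros DERIV_chain'[where g = u, OF _ that])
  define S where "S u t = (8 * D u (h / 2) t - D u h t) / h\<^sup>2" for u t
  have S_deriv: "(S u has_field_derivative S u' t) (at t)"
    if "\<And>t. (u has_field_derivative u' t) (at t)" for u u' t
    unfolding S_def by (intro DERIV_cdivide DERIV_diff DERIV_cmult D_deriv that)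
  have near: "\<bar>f t - S F2 t\<bar> \<le> W" if "t \<ge> 0" for t
  proof -
    \<comment> \<open>As a function of the step \<open>s\<close>, the combination \<open>G\<close> is chosen so that its second derivative
      is the second difference of \<open>f\<close> at \<open>t\<close>, while its own second difference with step \<open>h / 2\<close>
      is \<open>f t - g t\<close> up to the factor \<open>h\<^sup>2 / 4\<close>. This replaces the double integral.\<close>
    define G where "G s = f t * s\<^sup>2 / 2 - 2 * F2 (t + s) + F2 (t + 2 * s) / 4" for s
    define G' where "G' s = f t * s - 2 * F1 (t + s) + F1 (t + 2 * s) / 2" for s
    have d1: "(G has_field_derivative G' s) (at s)" for s
      unfolding G_def G'_def
      by (auto intro!: derivative_eq_intros DERIV_chain'[where g = F2, OF _ F2])
    have d2: "(G' has_field_derivative D f s t) (at s)" for s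
      unfolding G'_def D_def
      by (auto intro!: derivative_eq_intros DERIV_chain'[where g = F1, OF _ F1])
    have b: "\<bar>D f s t\<bar> \<le> W" if "s \<in> {0..2 * (h / 2)}" for s
    proof (cases "s = 0")
      case True
      thus ?thesis using W[of h t] h \<open>t \<ge> 0\<close> by (simp add: D_def)
    next
      case False
      thus ?thesis using W[of s t] that \<open>t \<ge> 0\<close> by (simp add: D_def)
    qed
    have "\<bar>G (2 * (h / 2)) - 2 * G (h / 2) + G 0\<bar> \<le> W * (h / 2)\<^sup>2"
      by (rule second_difference_bound[OF d1 d2 _ b]) (use h in auto)
    moreover have "G (2 * (h / 2)) - 2 * G (h / 2) + G 0 = (f t - S F2 t) * (h / 2)\<^sup>2"
      using h unfolding G_def S_def D_def by (simp add: field_simps power2_eq_square)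
    ultimately have "\<bar>f t - S F2 t\<bar> * (h / 2)\<^sup>2 \<le> W * (h / 2)\<^sup>2"
      by (simp add: abs_mult)
    thus ?thesis using h by (simp only: mult_le_cancel_right) auto
  qed
  have curv: "\<bar>S f t\<bar> \<le> 9 * W / h\<^sup>2" if "t \<ge> 0" for t
  proof -
    have "\<bar>D f (h / 2) t\<bar> \<le> W" "\<bar>D f h t\<bar> \<le> W"
      using W[of "h / 2" t] W[of h t] h that by (auto simp: D_def)
    hence "\<bar>8 * D f (h / 2) t - D f h t\<bar> \<le> 9 * W" by (simp add: abs_le_iff)
    thus ?thesis using h by (simp add: S_def divide_right_mono)
  qed
  show ?thesis
    by (rule that[OF S_deriv[OF F2] S_deriv[OF F1] near curv])
qed

text \<open>
  The tangent at \<open>x\<close> of the smoothed function. The quadratic error term is what the operator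
  turns into \<open>\<delta>\<close>.
\<close>

lemma affine_approximation:
  fixes f :: "real \<Rightarrow> real"
  assumes cont: "continuous_on {0..} f" and h: "h > 0" and x: "x \<ge> 0"
    and W: "\<And>s t. 0 < s \<Longrightarrow> s \<le> h \<Longrightarrow> t \<ge> 0 \<Longrightarrow> \<bar>f (t + 2 * s) - 2 * f (t + s) + f t\<bar> \<le> W"
  obtains a b where "\<And>t. t \<ge> 0 \<Longrightarrow> \<bar>f t - (a + b * (t - x))\<bar> \<le> W + 9 / 2 * (W / h\<^sup>2) * (t - x)\<^sup>2"
proof -
  \<comment> \<open>Extending \<open>f\<close> by the constant \<open>f 0\<close> to the left makes it continuous everywhere, so that
    two-sided derivatives of the smoothing exist also at \<open>0\<close>.\<close>
  have "continuous_on UNIV (\<lambda>t. f (max 0 t))"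
    by (rule continuous_on_compose2[OF cont]) (auto intro!: continuous_intros)
  then obtain g g' g'' where g: "\<And>t. (g has_field_derivative g' t) (at t)"
      "\<And>t. (g' has_field_derivative g'' t) (at t)"
    and near: "\<And>t. t \<ge> 0 \<Longrightarrow> \<bar>f (max 0 t) - g t\<bar> \<le> W"
    and curv: "\<And>t. t \<ge> 0 \<Longrightarrow> \<bar>g'' t\<bar> \<le> 9 * W / h\<^sup>2"
    by (rule Steklov_smoothing[OF _ h, of _ W]) (use W in \<open>auto simp: max_def\<close>)
  show ?thesis
  proof (rule that[of "g x" "g' x"])
    fix t :: real assume t: "t \<ge> 0"
    have "\<bar>g t - g x - g' x * (t - x)\<bar> \<le> 9 * W / h\<^sup>2 / 2 * (t - x)\<^sup>2"
      by (rule Taylor_second_order_bound[OF g])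
        (use t x in \<open>auto intro!: curv simp: closed_segment_eq_real_ivl split: if_splits\<close>)
    with near[OF t] t show "\<bar>f t - (g x + g' x * (t - x))\<bar> \<le> W + 9 / 2 * (W / h\<^sup>2) * (t - x)\<^sup>2"
      by (simp add: max_def split: if_splits)
  qed
qed

section \<open>Moduli of bounded functions\<close>

text \<open>
  The common bound \<open>K\<close> is needed because a supremum of reals is an upper bound only for sets that
  are bounded above.
\<close>

lemma SUP_SUP_upper:
  fixes \<phi> :: "'a \<Rightarrow> 'b \<Rightarrow> real"
  assumes "\<And>h x. h \<in> H \<Longrightarrow> x \<in> X \<Longrightarrow> \<phi> h x \<le> K" "h \<in> H" "x \<in> X"
  shows "\<phi> h x \<le> (SUP h\<in>H. SUP x\<in>X. \<phi> h x)"
proof -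
  have "\<phi> h x \<le> (SUP x\<in>X. \<phi> h x)"
    using assms by (intro cSUP_upper bdd_aboveI2[of _ _ K]) auto
  also have "\<dots> \<le> (SUP h\<in>H. SUP x\<in>X. \<phi> h x)"
    using assms by (intro cSUP_upper bdd_aboveI2[of _ _ K] cSUP_least) auto
  finally show ?thesis .
qed

lemma CB_halfline_moduli:
  assumes "f \<in> CB_halfline" "0 < h" "h \<le> d" "x \<ge> 0"
  shows modulus_continuity_upper: "\<bar>f (x + h) - f x\<bar> \<le> modulus_continuity f d"
    and modulus_smoothness2_upper:
      "\<bar>f (x + 2 * h) - 2 * f (x + h) + f x\<bar> \<le> modulus_smoothness2 f d"
proof -
  from assms(1) obtain K where K: "\<And>t. t \<ge> 0 \<Longrightarrow> \<bar>f t\<bar> \<le> K"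
    by (auto simp: CB_halfline_def bounded_iff)
  show "\<bar>f (x + h) - f x\<bar> \<le> modulus_continuity f d"
    unfolding modulus_continuity_def
  proof (rule SUP_SUP_upper[where K = "2 * K"])
    fix s t :: real assume "s \<in> {0<..d}" "t \<in> {0..}"
    thus "\<bar>f (t + s) - f t\<bar> \<le> 2 * K"
      using K[of "t + s"] K[of t] by (auto simp: abs_le_iff)
  qed (use assms in auto)
  show "\<bar>f (x + 2 * h) - 2 * f (x + h) + f x\<bar> \<le> modulus_smoothness2 f d"
    unfolding modulus_smoothness2_def
  proof (rule SUP_SUP_upper[where K = "4 * K"])
    fix s t :: real assume "s \<in> {0<..d}" "t \<in> {0..}"
    thus "\<bar>f (t + 2 * s) - 2 * f (t + s) + f t\<bar> \<le> 4 * K"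
      using K[of "t + 2 * s"] K[of "t + s"] K[of t] by (auto simp: abs_le_iff)
  qed (use assms in auto)
qed

section \<open>The estimate\<close>

text \<open>
  Both numbers are compared with the value \<open>a + b \<alpha>\<close> at \<open>x + \<alpha>\<close> of the affine approximation
  \<open>a + b (t - x)\<close>: the first by positivity of the operator, the second pointwise.
\<close>

lemma BSS_operator_near_shifted_value:
  assumes "n + p > 0" "x \<ge> 0" "f \<in> CB_halfline"
  shows "\<bar>BSS_operator n p f x - f (x + BSS_alpha n p x)\<bar>
    \<le> 13 / 2 * modulus_smoothness2 f (sqrt (BSS_delta n p x + (BSS_alpha n p x)\<^sup>2))"
proof -
  define \<alpha> where "\<alpha> = BSS_alpha n p x"
  define \<delta> where "\<delta> = BSS_delta n p x"
  define h where "h = sqrt (\<delta> + \<alpha>\<^sup>2)"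
  define W where "W = modulus_smoothness2 f h"
  have \<alpha>: "\<alpha> > 0" using assms by (simp add: \<alpha>_def BSS_alpha_eq del: of_nat_add)
  have \<delta>: "\<delta> \<ge> 0" using assms by (simp add: \<delta>_def BSS_delta_nonneg)
  have h: "h > 0" and h2: "h\<^sup>2 = \<delta> + \<alpha>\<^sup>2"
    using \<alpha> \<delta> by (auto simp: h_def add_nonneg_pos)
  have cont: "continuous_on {0..} f" using assms(3) by (simp add: CB_halfline_def)
  obtain a b where ab: "\<And>t. t \<ge> 0 \<Longrightarrow> \<bar>f t - (a + b * (t - x))\<bar> \<le> W + 9 / 2 * (W / h\<^sup>2) * (t - x)\<^sup>2"
    using affine_approximation[OF cont h assms(2), of W]
      modulus_smoothness2_upper[OF assms(3), of _ h] unfolding W_def by metis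
  define c where "c = 9 / 2 * (W / h\<^sup>2)"
  note adm = BSS_admissible_CB_halfline[OF assms]
  note quad = BSS_operator_quadratic[OF assms(1,2), folded \<alpha>_def \<delta>_def]
  have "BSS_operator n p f x \<le> (a + W) + b * \<alpha> + c * \<delta>"
    unfolding quad(2)[symmetric]
  proof (rule BSS_operator_mono[OF adm quad(1) _ assms(2)])
    fix t :: real assume "t \<ge> 0"
    from ab[OF this] show "f t \<le> (a + W) + b * (t - x) + c * (t - x)\<^sup>2"
      unfolding c_def by linarith
  qed
  moreover have "(a - W) + b * \<alpha> + (- c) * \<delta> \<le> BSS_operator n p f x"
    unfolding quad(2)[symmetric]
  proof (rule BSS_operator_mono[OF quad(1) adm _ assms(2)])
    fix t :: real assume "t \<ge> 0"
    from ab[OF this] show "(a - W) + b * (t - x) + (- c) * (t - x)\<^sup>2 \<le> f t"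
      unfolding c_def by linarith
  qed
  moreover have "\<bar>f (x + \<alpha>) - (a + b * \<alpha>)\<bar> \<le> W + c * \<alpha>\<^sup>2"
    using ab[of "x + \<alpha>"] \<alpha> assms(2) by (simp add: c_def)
  moreover have "c * \<delta> + c * \<alpha>\<^sup>2 = 9 / 2 * W"
  proof -
    have "c * \<delta> + c * \<alpha>\<^sup>2 = c * h\<^sup>2" by (simp only: h2 distrib_left)
    thus ?thesis using h by (simp add: c_def)
  qed
  ultimately have "\<bar>BSS_operator n p f x - f (x + \<alpha>)\<bar> \<le> 13 / 2 * W"
    by linarith
  thus ?thesis by (simp add: W_def h_def \<alpha>_def \<delta>_def)
qed

theorem theorem1:
  shows "\<exists>C::real. C > 0 \<and>
    (\<forall>(n::nat) (p::nat) (f::real \<Rightarrow> real) (x::real).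
       n \<ge> 1 \<longrightarrow> p \<ge> 1 \<longrightarrow> f \<in> CB_halfline \<longrightarrow> x \<ge> 0 \<longrightarrow>
       \<bar>BSS_operator n p f x - f x\<bar>
         \<le> C * modulus_smoothness2 f (sqrt (BSS_delta n p x + (BSS_alpha n p x)\<^sup>2))
           + modulus_continuity f (BSS_alpha n p x))"
proof (intro exI[of _ "13 / 2"] conjI allI impI)
  fix n p :: nat and f :: "real \<Rightarrow> real" and x :: real
  assume np: "n \<ge> 1" "p \<ge> 1" and f: "f \<in> CB_halfline" and x: "x \<ge> 0"
  have "\<bar>f (x + BSS_alpha n p x) - f x\<bar> \<le> modulus_continuity f (BSS_alpha n p x)"
    by (rule modulus_continuity_upper[OF f]) (use np x in \<open>auto simp: BSS_alpha_eq\<close>)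
  with BSS_operator_near_shifted_value[OF _ x f, of n p] np
  show "\<bar>BSS_operator n p f x - f x\<bar>
         \<le> 13 / 2 * modulus_smoothness2 f (sqrt (BSS_delta n p x + (BSS_alpha n p x)\<^sup>2))
           + modulus_continuity f (BSS_alpha n p x)"
    by linarith
qed simp

end
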